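(* Let $s\in\mathbb{F}_q$ be such that $1-s^2\in\mathcal{C}$. The polynomial $g_s(y)$ is irreducible over $\mathbb{F}_q$ if and only if $s=(B+B^{-1})/2$ for some element $B\in\mathbb{F}_q[i]$ of multiplicative order $2E$. Moreover, for such $s$, $g_s(y)$ is the irreducible polynomial in $\mathbb{F}_q[y]$ given by $$g_s(y) = \frac{\tau^2}{2}(y^2-y)\prod_{a\in\mathcal{C}}(y-a)^2 + 1 - s.$$
   Context: $\mathbb{F}_q$ is a finite field with $q$ elements, $q$ a power of an odd prime; $n=(q+1)/2$; for $s\in\mathbb{F}_q$, $g_s(y) := y^n+(1-y)^n-s \in \mathbb{F}_q[y]$. $\rho$ is the quadratic character on $\mathbb{F}_q$ (with $\rho(0)=0$), and $\mathcal{C} := \{a \in \mathbb{F}_q : \rho(a)=\rho(1-a)=1\}$. $\tau = 1$ if $q\equiv 1 \pmod 4$ and $\tau = 2$ if $q \equiv 3 \pmod 4$. $i\in\mathbb{F}_{q^2}$ is a fixed square root of $-1$. $E := (q-\rho(-1))/2$, an even integer. *)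

theory Defs
  imports
    "HOL-Library.Cardinality"
    "HOL-Computational_Algebra.Computational_Algebra"
    "HOL-Computational_Algebra.Nth_Powers"
    "HOL-Number_Theory.Prime_Powers"
    "HOL-Algebra.Algebraic_Closure_Type"
    "HOL-Algebra.Multiplicative_Group"
begin

text \<open>
  The field with \<open>q\<close> elements is a type \<open>'a\<close> of class \<^class>\<open>finite_field\<close>, with \<open>q = CARD('a)\<close>.
  Quantities that depend only on the field take an argument \<open>TYPE('a)\<close>.
\<close>

definition quad_char :: "'a::finite_field \<Rightarrow> int" where
  "quad_char a = (if a = 0 then 0 else if is_square a then 1 else -1)"

definition setC :: "'a::finite_field set" where
  "setC = {a. quad_char a = 1 \<and> quad_char (1 - a) = 1}"

definition g_poly :: "'a::finite_field \<Rightarrow> 'a poly" where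
  "g_poly s = (let n = (CARD('a) + 1) div 2; y = [:0, 1:] in y ^ n + (1 - y) ^ n - [:s:])"

text \<open>Only meaningful for odd \<open>q\<close>, where the second case is \<open>q mod 4 = 3\<close>.\<close>

definition tau :: "'a::finite_field itself \<Rightarrow> nat" where
  "tau _ = (if CARD('a) mod 4 = 1 then 1 else 2)"

text \<open>For odd \<open>q\<close> the division by 2 is exact and the integer is positive.\<close>

definition E_num :: "'a::finite_field itself \<Rightarrow> nat" where
  "E_num _ = nat ((int CARD('a) - quad_char (-1 :: 'a)) div 2)"

text \<open>
  All extensions of the base field live in its algebraic closure. There, every square root of
  \<open>-1\<close> lies in the subfield with \<open>q\<^sup>2\<close> elements.
  The ring generated by the base field and \<open>x\<close> is the set of values at \<open>x\<close> of the polynomials over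
  the base field; if \<open>x\<close> already lies in the base field, this is (the image of) the base field.
\<close>

definition adjoin :: "'a::field alg_closure \<Rightarrow> 'a alg_closure set" where
  "adjoin x = {poly (map_poly to_ac p) x |p. True}"

definition mult_order :: "'a::field \<Rightarrow> nat" where
  "mult_order x = group.ord (Multiplicative_Group.mult_of ring_of_type_algebra) x"

end

theory Submission
  imports Defs "HOL-Number_Theory.Residues"
begin

text \<open>
  Write \<open>q = CARD('a)\<close>, \<open>E = E_num TYPE('a)\<close> and \<open>\<epsilon> = \<rho>(-1)\<close>, so \<open>q = 2E + \<epsilon>\<close>. The whole
  argument rests on a trigonometric substitution in the algebraic closure: with \<open>u = (z +
  1/z)/2\<close> and \<open>v = (z - 1/z)/(2i)\<close> one has \<open>u\<^sup>2 + v\<^sup>2 = 1\<close>, and every \<open>y\<close> is such a \<open>u\<^sup>2\<close>. For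
  \<open>n = (q + 1)/2\<close> this turns \<open>y\<^sup>n + (1 - y)\<^sup>n\<close> into \<open>u u\<^sup>q + v v\<^sup>q\<close>, where the Frobenius map
  acts on \<open>z\<close> and on \<open>i\<close> only; the two residue classes of \<open>q\<close> modulo 4 both give \<open>(w\<^sup>E +
  1/w\<^sup>E)/2\<close>, where \<open>w = z\<^sup>2\<close> and \<open>2y - 1 = (w + 1/w)/2\<close>. Hence \<open>g\<^sub>s(y) = T\<^sub>E(2y - 1) - s\<close> with
  the Chebyshev polynomial \<open>T\<^sub>E\<close> (\<open>g_poly_eq_cheb\<close>), which has degree \<open>E\<close>.

  Suppose \<open>s = (B + 1/B)/2\<close> with \<open>B\<close> of order \<open>2E\<close>. A root \<open>y\<close> of \<open>g\<^sub>s\<close> comes from a \<open>w\<close> with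
  \<open>w\<^sup>E\<close> equal to \<open>B\<close> or \<open>1/B\<close>, and as every prime factor of \<open>E\<close> divides \<open>2E\<close>, such a \<open>w\<close> has
  order \<open>2E\<^sup>2\<close>. If \<open>y\<close> is fixed by the \<open>k\<close>-th power of Frobenius, then \<open>w\<close> is mapped to \<open>w\<close> or
  \<open>1/w\<close>, so \<open>2E\<^sup>2\<close> divides \<open>q\<^sup>k - \<delta>\<close> with \<open>\<delta> = \<plusminus>1\<close>. Expanding \<open>(2E + \<epsilon>)\<^sup>k\<close> modulo \<open>2E\<^sup>2\<close> shows
  that \<open>E\<close> divides \<open>k\<close>. So \<open>y\<close> has at least \<open>E\<close> conjugates and \<open>g\<^sub>s\<close> is irreducible
  (\<open>factor_degree_ge\<close>, \<open>irreducible_g_poly\<close>).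

  Conversely, \<open>1 - s\<^sup>2 = t\<^sup>2\<close> provides \<open>B = s + it\<close> with \<open>B\<^bsup>2E\<^esup> = 1\<close> (\<open>exists_witness\<close>). If
  its order is a proper divisor of \<open>2E\<close>, some prime \<open>l\<close> divides the cofactor, and \<open>l\<close> divides
  \<open>E\<close> because \<open>E\<close> is even. An \<open>l\<close>-th root \<open>D\<close> of \<open>B\<close> still satisfies \<open>D\<^bsup>2E\<^esup> = 1\<close>, so \<open>r = (D +
  1/D)/2\<close> lies in the base field, and \<open>s = T\<^sub>l(r)\<close>. From \<open>T\<^sub>E = T\<^sub>l \<circ> T\<^bsub>E/l\<^esub>\<close> it follows that
  \<open>T\<^bsub>E/l\<^esub> - r\<close> divides \<open>T\<^sub>E - s\<close> (\<open>g_poly_reducible\<close>).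

  For the product formula only \<open>s = 1\<close> matters, since \<open>g\<^sub>s = g\<^sub>1 + (1 - s)\<close>. The roots of
  \<open>g\<^sub>1\<close> come from \<open>z\<^bsup>2E\<^esup> = 1\<close>, hence \<open>y = u\<^sup>2\<close> and \<open>1 - y = v\<^sup>2\<close> with \<open>u\<close>, \<open>v\<close> in the base
  field; so they are \<open>0\<close>, \<open>1\<close> and elements of \<open>C\<close>. The derivatives of \<open>g\<^sub>1\<close> show that \<open>0\<close> and
  \<open>1\<close> are simple roots and the elements of \<open>C\<close> are double roots (\<open>g_poly_product\<close>).
\<close>

section \<open>Chebyshev polynomials\<close>

text \<open>
  The Chebyshev polynomials of the first kind.
\<close>

fun cheb :: "nat \<Rightarrow> 'a::comm_ring_1 poly" where
  "cheb 0 = 1"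
| "cheb (Suc 0) = [:0, 1:]"
| "cheb (Suc (Suc k)) = [:0, 2:] * cheb (Suc k) - cheb k"

lemma poly_cheb_Suc_Suc:
  "poly (cheb (Suc (Suc k))) x = 2 * x * poly (cheb (Suc k)) x - poly (cheb k) x"
  by (simp add: algebra_simps)

text \<open>
  The product formula for cosines. It follows from the recurrence alone, so it holds in every
  characteristic; the shift \<open>j\<close> replaces the difference of the two indices.
\<close>

lemma two_cheb_times_cheb: "2 * cheb m * cheb (m + j) = cheb (2 * m + j) + cheb j"
proof (induction m arbitrary: j rule: cheb.induct)
  case 1
  show ?case by simp
next
  case 2
  have "[:0, 2:] = 2 * ([:0, 1:] :: 'a poly)"
    by (simp add: numeral_poly)
  thus ?case by simp
next
  case (3 k)
  define Y :: "'a poly" where "Y = [:0, 2:]"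
  have rec: "cheb (Suc (Suc i)) = Y * cheb (Suc i) - cheb i" for i
    by (simp add: Y_def)
  have "2 * cheb (Suc (Suc k)) * cheb (Suc (Suc k) + j) =
      Y * (2 * cheb (Suc k) * cheb (Suc k + Suc j)) - 2 * cheb k * cheb (k + Suc (Suc j))"
    by (simp only: add_Suc add_Suc_right rec)
       (simp add: algebra_simps del: cheb.simps mult_pCons_left mult_pCons_right)
  also have "\<dots> = Y * (cheb (Suc (Suc (Suc (2 * k + j)))) + cheb (Suc j))
                    - (cheb (Suc (Suc (2 * k + j))) + cheb (Suc (Suc j)))"
    using "3.IH"(1)[of "Suc j"] "3.IH"(2)[of "Suc (Suc j)"] by simp
  also have "\<dots> = cheb (2 * Suc (Suc k) + j) + cheb j"
    using rec[of "Suc (Suc (2 * k + j))"] rec[of j]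
    by (simp add: algebra_simps del: cheb.simps)
  finally show ?case .
qed

text \<open>
  Applying the product formula to the indices \<open>m\<close> and \<open>(k + 1) m\<close> shows that the polynomials
  \<open>cheb (l * m)\<close> satisfy, in \<open>l\<close>, the Chebyshev recurrence with \<open>cheb m\<close> in place of the
  variable.
\<close>

lemma cheb_mult: "(cheb (l * m) :: 'a::comm_ring_1 poly) = pcompose (cheb l) (cheb m)"
proof (induction l rule: cheb.induct)
  case (3 k)
  have "(cheb (Suc (Suc k) * m) :: 'a poly) = 2 * cheb m * cheb (m + k * m) - cheb (k * m)"
    by (subst two_cheb_times_cheb) (simp add: algebra_simps mult_2_right)
  also have "\<dots> = [:0, 2:] \<circ>\<^sub>p cheb m * (cheb (Suc k) \<circ>\<^sub>p cheb m) - cheb k \<circ>\<^sub>p cheb m"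
    using 3 by (simp add: pcompose_pCons numeral_poly mult.commute)
  also have "\<dots> = pcompose (cheb (Suc (Suc k))) (cheb m)"
    by (simp add: pcompose_diff pcompose_mult del: mult_pCons_left)
  finally show ?case .
qed (simp_all add: pcompose_1 pcompose_pCons)

lemma poly_cheb:
  fixes w :: "'a::field"
  assumes "w \<noteq> 0" "(2::'a) \<noteq> 0"
  shows "poly (cheb k) ((w + inverse w) / 2) = (w ^ k + inverse w ^ k) / 2"
proof (induction k rule: cheb.induct)
  case (3 k)
  have four: "(4::'a) \<noteq> 0"
    using assms(2) mult_eq_0_iff[of "2::'a" 2] by simp
  have "poly (cheb (Suc (Suc k))) ((w + inverse w) / 2) =
      (w + inverse w) * ((w ^ Suc k + inverse w ^ Suc k) / 2) - (w ^ k + inverse w ^ k) / 2"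
    using assms by (simp only: poly_cheb_Suc_Suc 3) (simp add: four)
  also have "\<dots> = (w ^ Suc (Suc k) + inverse w ^ Suc (Suc k)) / 2"
    using assms four by (simp add: field_simps)
  finally show ?case .
qed (use assms in auto)

lemma degree_lead_coeff_cheb:
  assumes "(2::'a::idom) \<noteq> 0"
  shows "degree (cheb (Suc k) :: 'a poly) = Suc k \<and> lead_coeff (cheb (Suc k) :: 'a poly) = 2 ^ k"
proof (induction k rule: less_induct)
  case (less k)
  show ?case
  proof (cases k)
    case (Suc j)
    define A :: "'a poly" where "A = [:0, 2:] * cheb (Suc j)"
    have IH: "degree (cheb (Suc j) :: 'a poly) = Suc j" "lead_coeff (cheb (Suc j) :: 'a poly) = 2 ^ j"
      using less.IH[of j] Suc by auto
    have ne: "(cheb (Suc j) :: 'a poly) \<noteq> 0"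
      using IH(1) by auto
    have "degree A = Suc (Suc j)"
      using assms ne IH unfolding A_def by (subst degree_mult_eq) auto
    moreover have "lead_coeff A = 2 ^ Suc j"
      unfolding A_def using assms IH(2) by (subst lead_coeff_mult) simp
    ultimately have A: "degree A = Suc (Suc j)" "lead_coeff A = 2 ^ Suc j"
      by blast+
    have "degree (cheb j :: 'a poly) \<le> j"
      using less.IH[of "j - 1"] Suc by (cases j) auto
    hence small: "degree (- cheb j :: 'a poly) < degree A"
      using A by simp
    have "cheb (Suc k) = A + (- cheb j)"
      by (simp add: Suc A_def)
    thus ?thesis
      using degree_add_eq_left[OF small] lead_coeff_add_le[of "- cheb j" A] small A Suc
      by (metis add.commute)
  qed (use assms in auto)
qed

text \<open>
  The substitution of \<open>2y - 1\<close> multiplies the leading coefficient \<open>2\<^sup>k\<close> by \<open>2\<^bsup>k+1\<^esup>\<close>.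
\<close>

lemma degree_lead_coeff_cheb_shift:
  assumes "(2::'a::idom) \<noteq> 0"
  shows "degree (pcompose (cheb (Suc k)) [:-1, 2::'a:] - [:c:]) = Suc k"
    and "lead_coeff (pcompose (cheb (Suc k)) [:-1, 2::'a:] - [:c:]) = 2 ^ Suc (2 * k)"
proof -
  define A where "A = pcompose (cheb (Suc k)) [:-1, 2::'a:]"
  note C = degree_lead_coeff_cheb[OF assms, of k]
  have deg: "degree A = Suc k"
    using C assms unfolding A_def degree_pcompose by simp
  have lc: "lead_coeff A = 2 ^ Suc (2 * k)"
  proof -
    have "lead_coeff A = lead_coeff (cheb (Suc k) :: 'a poly) * 2 ^ degree (cheb (Suc k) :: 'a poly)"
      unfolding A_def using assms by (subst lead_coeff_comp) auto
    also have "\<dots> = 2 ^ k * 2 ^ Suc k"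
      using C by metis
    also have "\<dots> = 2 ^ Suc (2 * k)"
    proof -
      have "k + Suc k = Suc (2 * k)"
        by simp
      thus ?thesis
        by (metis power_add)
    qed
    finally show ?thesis .
  qed
  have "A - [:c:] = A + (- [:c:])"
    by (rule diff_conv_add_uminus)
  hence d': "degree (A - [:c:]) = Suc k"
    using degree_add_eq_left[of "- [:c:]" A] deg by (simp del: pCons_0_0 minus_pCons)
  show d: "degree (pcompose (cheb (Suc k)) [:-1, 2::'a:] - [:c:]) = Suc k"
    using d' unfolding A_def .
  show "lead_coeff (pcompose (cheb (Suc k)) [:-1, 2::'a:] - [:c:]) = 2 ^ Suc (2 * k)"
    unfolding d using lc deg unfolding A_def by simp
qed

section \<open>Evaluation in the algebraic closure\<close>

abbreviation ev :: "'a::field poly \<Rightarrow> 'a alg_closure \<Rightarrow> 'a alg_closure" where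
  "ev p x \<equiv> poly (map_poly to_ac p) x"

lemma ev_pCons [simp]: "ev (pCons a p) x = to_ac a + x * ev p x"
  by (simp add: map_poly_pCons)

lemma map_poly_to_ac_add: "map_poly to_ac (p + q) = map_poly to_ac p + map_poly to_ac q"
  by (rule poly_eqI) (simp add: coeff_map_poly)

lemma ev_add [simp]: "ev (p + q) x = ev p x + ev q x"
  by (simp add: map_poly_to_ac_add)

lemma ev_smult [simp]: "ev (smult c p) x = to_ac c * ev p x"
  by (induction p) (simp_all add: algebra_simps)

lemma ev_diff [simp]: "ev (p - q) x = ev p x - ev q x"
  using ev_add[of "p - q" q x] by simp

lemma ev_mult [simp]: "ev (p * q) x = ev p x * ev q x"
  by (induction p) (simp_all add: algebra_simps)

lemma ev_power [simp]: "ev (p ^ k) x = ev p x ^ k"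
  by (induction k) simp_all

lemma ev_to_ac [simp]: "ev p (to_ac a) = to_ac (poly p a)"
  by (induction p) simp_all

lemma ev_pcompose [simp]: "ev (pcompose p q) x = ev p (ev q x)"
  by (induction p) (simp_all add: pcompose_pCons)

lemma ev_cheb [simp]: "ev (cheb k) x = poly (cheb k) x"
  by (induction k rule: cheb.induct) (simp_all add: algebra_simps)

lemma degree_map_poly_to_ac [simp]: "degree (map_poly to_ac p) = degree p"
proof (cases "p = 0")
  case False
  thus ?thesis by (intro map_poly_degree_eq) auto
qed simp

text \<open>
  An algebraically closed field is infinite, so polynomial functions on it determine their
  polynomials. The proof is direct: if \<open>r = p - q\<close> were nonzero but vanished everywhere, then
  \<open>1 + y r\<close> would be a nonconstant polynomial with the value 1 everywhere, hence without a root.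
\<close>

lemma poly_eqI_ev:
  assumes "\<And>x. ev p x = ev q x"
  shows "p = q"
proof (rule ccontr)
  assume "p \<noteq> q"
  hence "degree (map_poly to_ac (pCons 1 (p - q))) > 0"
    by (simp del: map_poly_pCons)
  then obtain x where "ev (pCons 1 (p - q)) x = 0"
    using alg_closed_imp_poly_has_root by blast
  thus False
    using assms by (simp del: map_poly_pCons)
qed

text \<open>
  A polynomial whose roots in the algebraic closure are all rational over the base field
  splits already there: divide by one linear factor after the other.
\<close>

lemma prod_roots_order:
  fixes p :: "'a::field poly"
  assumes "p \<noteq> 0" "\<And>x. ev p x = 0 \<Longrightarrow> x \<in> range to_ac"
  shows "p = smult (lead_coeff p) (\<Prod>a | poly p a = 0. [:-a, 1:] ^ order a p)"
proof -
  have "p = smult (lead_coeff p) (\<Prod>a\<in>#proots p. [:-a, 1:])"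
    using assms
  proof (induction "degree p" arbitrary: p)
    case 0
    then obtain c where "p = [:c:]"
      by (metis degree_eq_zeroE)
    thus ?case by simp
  next
    case (Suc k)
    then obtain x where x: "ev p x = 0"
      using alg_closed_imp_poly_has_root[of "map_poly to_ac p"] by auto
    then obtain a where "x = to_ac a"
      using Suc.prems(2) by blast
    hence "poly p a = 0"
      using x by simp
    then obtain r where r: "p = [:-a, 1:] * r"
      by (metis poly_eq_0_iff_dvd dvdE)
    have "r \<noteq> 0"
      using Suc.prems(1) r by auto
    hence "degree r = k"
      using Suc.hyps(2) unfolding r by (subst (asm) degree_mult_eq) auto
    moreover have "x \<in> range to_ac" if "ev r x = 0" for x
      using Suc.prems(2)[of x] that unfolding r by simp
    ultimately have IH: "r = smult (lead_coeff r) (\<Prod>a\<in>#proots r. [:-a, 1:])"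
      using Suc.hyps(1)[of r] \<open>r \<noteq> 0\<close> by simp
    have "proots p = add_mset a (proots r)"
      using \<open>r \<noteq> 0\<close> unfolding r by (subst proots_mult) auto
    moreover have "lead_coeff p = lead_coeff r"
      unfolding r by (subst lead_coeff_mult) simp
    ultimately have "smult (lead_coeff p) (\<Prod>a\<in>#proots p. [:-a, 1:]) =
                       [:-a, 1:] * smult (lead_coeff r) (\<Prod>a\<in>#proots r. [:-a, 1:])"
      by (simp del: mult_pCons_left)
    thus ?case
      using IH r by metis
  qed
  also have "(\<Prod>a\<in>#proots p. [:-a, 1:]) = (\<Prod>a | poly p a = 0. [:-a, 1:] ^ order a p)"
    using assms(1) by (simp add: image_prod_mset_multiplicity)
  finally show ?thesis .
qed

section \<open>The Frobenius map\<close>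

lemma card_field_gt_1: "CARD('a::finite_field) > 1"
  using card_mono[of UNIV "{0, 1 :: 'a}"] by simp

lemma two_neq_0:
  assumes "odd CARD('a::finite_field)"
  shows "(2::'a) \<noteq> 0" "(2::'a alg_closure) \<noteq> 0"
proof -
  show *: "(2::'a) \<noteq> 0"
  proof
    assume "(2::'a) = 0"
    hence "CHAR('a) dvd 2"
      using of_nat_eq_0_iff_char_dvd[where 'a = 'a, of 2] by simp
    moreover have "Factorial_Ring.prime CHAR('a)" "CHAR('a) dvd CARD('a)"
      using CHAR_dvd_CARD[where 'a = 'a] by auto
    ultimately show False
      using assms by (metis primes_dvd_imp_eq two_is_prime_nat)
  qed
  thus "(2::'a alg_closure) \<noteq> 0"
    using to_ac_eq_0_iff[of "2::'a"] by (simp del: to_ac_eq_0_iff)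
qed

lemma card_field_eq_CHAR_power:
  assumes "primepow CARD('a::finite_field)"
  obtains k where "CARD('a) = CHAR('a) ^ k"
proof -
  obtain p k where pk: "Factorial_Ring.prime p" "CARD('a) = p ^ k"
    using assms by (auto simp: primepow_def)
  have "Factorial_Ring.prime CHAR('a)" "CHAR('a) dvd p ^ k"
    using CHAR_dvd_CARD[where 'a = 'a] pk by auto
  hence "CHAR('a) = p"
    using pk(1) prime_dvd_power primes_dvd_imp_eq by blast
  thus ?thesis using pk that by blast
qed

lemma power_card_power_add:
  fixes x y :: "'a::finite_field alg_closure"
  assumes "primepow CARD('a)"
  shows "(x + y) ^ (CARD('a) ^ j) = x ^ (CARD('a) ^ j) + y ^ (CARD('a) ^ j)"
proof -
  obtain k where "CARD('a) = CHAR('a) ^ k"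
    using card_field_eq_CHAR_power[OF assms] by blast
  thus ?thesis
    using freshmans_dream'[where 'a = "'a alg_closure", of "CARD('a) ^ j" "k * j"]
    by (simp add: power_mult)
qed

lemma power_card_power_diff:
  fixes x y :: "'a::finite_field alg_closure"
  assumes "primepow CARD('a)"
  shows "(x - y) ^ (CARD('a) ^ j) = x ^ (CARD('a) ^ j) - y ^ (CARD('a) ^ j)"
  using power_card_power_add[OF assms, of "x - y" y j] by simp

lemma power_card_add:
  fixes x y :: "'a::finite_field alg_closure"
  assumes "primepow CARD('a)"
  shows "(x + y) ^ CARD('a) = x ^ CARD('a) + y ^ CARD('a)"
    and "(x - y) ^ CARD('a) = x ^ CARD('a) - y ^ CARD('a)"
  using power_card_power_add[OF assms, of x y 1] power_card_power_diff[OF assms, of x y 1] by simp_all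

lemma to_ac_power_card [simp]: "to_ac (a::'a::finite_field) ^ CARD('a) = to_ac a"
  by (metis finite_field_power_card_eq_same to_ac_power)

lemma to_ac_power_card_power [simp]: "to_ac (a::'a::finite_field) ^ (CARD('a) ^ j) = to_ac a"
  by (induction j) (simp_all add: power_mult)

lemma two_power_card: "(2::'a::finite_field alg_closure) ^ CARD('a) = 2"
  using to_ac_power_card[of "2::'a"] by simp

text \<open>
  The equation \<open>x\<^sup>q = x\<close> has at most \<open>q\<close> solutions, and the elements of the base field are
  already \<open>q\<close> solutions.
\<close>

lemma power_card_eq_self_imp_range:
  fixes x :: "'a::finite_field alg_closure"
  assumes "x ^ CARD('a) = x"
  obtains a where "x = to_ac a"
proof -
  define p :: "'a alg_closure poly" where "p = monom 1 CARD('a) - [:0, 1:]"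
  have card: "CARD('a) > 1"
    by (rule card_field_gt_1)
  have "x \<in> range to_ac"
  proof (rule ccontr)
    assume x: "x \<notin> range to_ac"
    have cx: "coeff p CARD('a) = 1"
      using card by (simp add: p_def coeff_pCons split: nat.splits)
    hence "p \<noteq> 0" by auto
    have "degree p \<le> CARD('a)"
      using card unfolding p_def by (intro degree_diff_le) (auto simp: degree_monom_le)
    moreover have "card (insert x (range to_ac)) \<le> card {x. poly p x = 0}"
      using assms \<open>p \<noteq> 0\<close> by (intro card_mono poly_roots_finite) (auto simp: p_def poly_monom)
    moreover have "card (insert x (range (to_ac :: 'a \<Rightarrow> _))) = Suc CARD('a)"
      using x by (simp add: card_image inj_to_ac)
    ultimately show False
      using card_poly_roots_bound[OF \<open>p \<noteq> 0\<close>] by linarith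
  qed
  thus ?thesis using that by blast
qed

lemma ev_power_card:
  fixes p :: "'a::finite_field poly"
  assumes "primepow CARD('a)"
  shows "ev p (x ^ (CARD('a) ^ j)) = ev p x ^ (CARD('a) ^ j)"
  by (induction p) (simp_all add: power_card_power_add[OF assms] power_mult_distrib)

text \<open>
  Frobenius permutes the roots of \<open>f\<close>. Among the \<open>degree f + 1\<close> iterates \<open>y\<close>, \<open>y\<^sup>q\<close>, ... two
  must coincide, and the injectivity of Frobenius cancels the smaller exponent.
\<close>

lemma conjugate_fixed_of_root:
  fixes f :: "'a::finite_field poly"
  assumes "primepow CARD('a)" "f \<noteq> 0" "ev f y = 0"
  obtains k where "0 < k" "k \<le> degree f" "y ^ (CARD('a) ^ k) = y"
proof -
  define c where "c j = y ^ (CARD('a) ^ j)" for j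
  define R where "R = {x. ev f x = 0}"
  have "map_poly to_ac f \<noteq> 0"
    using assms(2) by (simp add: map_poly_eq_0_iff)
  hence fin: "finite R" and card: "card R \<le> degree f"
    unfolding R_def using poly_roots_finite card_poly_roots_bound
      degree_map_poly_to_ac by (blast, metis)
  have "c ` {..degree f} \<subseteq> R"
    by (auto simp: R_def c_def ev_power_card[OF assms(1)] assms(3) power_0_left)
  hence "\<not> inj_on c {..degree f}"
    using card_inj_on_le[of c "{..degree f}" R] fin card by auto
  then obtain a b where ab: "a < b" "b \<le> degree f" "c a = c b"
    by (metis (mono_tags, lifting) atMost_iff inj_onI linorder_neqE_nat)
  have "CARD('a) ^ b = CARD('a) ^ (b - a) * CARD('a) ^ a"
    using ab by (simp flip: power_add)
  hence "(y ^ (CARD('a) ^ (b - a)) - y) ^ (CARD('a) ^ a) = 0"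
    using ab(3) unfolding power_card_power_diff[OF assms(1)]
    by (simp add: c_def flip: power_mult)
  thus ?thesis
    using that[of "b - a"] ab by simp
qed

section \<open>Square roots of minus one and the exponent\<close>

lemma power_eq_1_iff_mult_order_dvd:
  fixes x :: "'a::field"
  assumes "x \<noteq> 0"
  shows "x ^ k = 1 \<longleftrightarrow> mult_order x dvd k"
proof -
  interpret R: field "ring_of_type_algebra :: 'a ring" ..
  define G where "G = Multiplicative_Group.mult_of (ring_of_type_algebra :: 'a ring)"
  interpret group G
    unfolding G_def by (rule R.field_mult_group)
  have one: "\<one>\<^bsub>G\<^esub> = 1" and x: "x \<in> carrier G"
    using assms by (auto simp: G_def ring_of_type_algebra_def)
  have pow: "x [^]\<^bsub>G\<^esub> j = x ^ j" for j :: nat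
    by (induction j) (auto simp: one G_def ring_of_type_algebra_def mult.commute)
  have "x ^ k = 1 \<longleftrightarrow> group.ord G x dvd k"
    using pow_eq_id[OF x, of k] by (simp only: pow one)
  thus ?thesis
    by (simp only: mult_order_def G_def)
qed

lemma ac_minus_one_square: obtains i :: "'a::field alg_closure" where "i ^ 2 = -1"
  using nth_root_exists[of 2 "-1 :: 'a alg_closure"] by auto

text \<open>
  Depending on \<open>q\<close> modulo 4, Frobenius fixes \<open>i\<close> or negates it, that is, \<open>i\<close> is rational over
  the base field or not. This determines \<open>\<rho>(-1)\<close>, so in both cases \<open>i\<^sup>q = \<rho>(-1) i\<close> and \<open>q = 2E
  + \<rho>(-1)\<close>.
\<close>

lemma square_root_of_minus_one_cases:
  fixes i :: "'a::finite_field alg_closure"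
  assumes "odd CARD('a)" "i ^ 2 = -1"
  obtains (split) "CARD('a) mod 4 = 1" "CARD('a) = Suc (2 * E_num TYPE('a))" "i ^ CARD('a) = i"
        | (inert) "CARD('a) mod 4 = 3" "Suc CARD('a) = 2 * E_num TYPE('a)" "i ^ CARD('a) = -i"
proof -
  have pow: "i ^ (2 * k) = (-1) ^ k" for k
    using assms(2) by (simp add: power_mult)
  consider m where "CARD('a) = Suc (2 * (2 * m))" | m where "CARD('a) = Suc (2 * (2 * m + 1))"
    using assms(1) by (elim oddE) (metis Suc_eq_plus1 evenE oddE)
  thus ?thesis
  proof cases
    case 1
    have iq: "i ^ CARD('a) = i"
      unfolding 1 power_Suc pow by simp
    then obtain j where "i = to_ac j"
      using power_card_eq_self_imp_range by blast
    hence "to_ac (j ^ 2) = to_ac (-1)"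
      using assms(2) by simp
    hence "-1 = j ^ 2"
      by (simp only: to_ac_eq_iff)
    hence "quad_char (-1 :: 'a) = 1"
      by (auto simp: quad_char_def is_nth_power_def)
    hence "E_num TYPE('a) = 2 * m"
      by (simp add: E_num_def 1)
    thus ?thesis
      using iq split 1 by simp
  next
    case 2
    have iq: "i ^ CARD('a) = -i"
      unfolding 2 power_Suc pow by simp
    have "\<not> is_square (-1 :: 'a)"
    proof
      assume "is_square (-1 :: 'a)"
      then obtain j :: 'a where "-1 = j ^ 2"
        by (auto simp: is_nth_power_def)
      hence "i ^ 2 = to_ac j ^ 2"
        using assms(2) by (metis to_ac_1 to_ac_minus to_ac_power)
      hence "i = to_ac j \<or> i = to_ac (-j)"
        by (simp add: power2_eq_iff)
      hence "i ^ CARD('a) = i"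
        using to_ac_power_card by blast
      hence "2 * i = 0"
        using iq by (metis add.right_inverse mult_2)
      thus False
        using two_neq_0[OF assms(1)] assms(2) by auto
    qed
    hence "quad_char (-1 :: 'a) = -1"
      by (auto simp: quad_char_def)
    hence "E_num TYPE('a) = 2 * m + 2"
      by (simp add: E_num_def 2)
    moreover have "CARD('a) mod 4 = 3"
      unfolding 2 by presburger
    ultimately show ?thesis
      using iq inert 2 by simp
  qed
qed

lemma E_num_even_pos:
  assumes "odd CARD('a::finite_field)"
  shows "even (E_num TYPE('a))" "E_num TYPE('a) \<ge> 2"
proof -
  obtain i :: "'a alg_closure" where i: "i ^ 2 = -1"
    using ac_minus_one_square .
  show ev: "even (E_num TYPE('a))"
    using assms i by (cases rule: square_root_of_minus_one_cases) presburger+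
  have "E_num TYPE('a) > 0"
    using assms i by (cases rule: square_root_of_minus_one_cases) (use card_field_gt_1[where 'a = 'a] in auto)
  thus "E_num TYPE('a) \<ge> 2"
    using ev by presburger
qed

section \<open>Trigonometric parametrisation\<close>

text \<open>
  Choose \<open>u\<close> and \<open>v\<close> with \<open>u\<^sup>2 = y\<close> and \<open>v\<^sup>2 = 1 - y\<close>; then \<open>z = u + iv\<close> has the inverse \<open>u -
  iv\<close>.
\<close>

lemma ev_cos_square:
  fixes y :: "'a::finite_field alg_closure"
  assumes "odd CARD('a)"
  obtains z where "z \<noteq> 0" "y = ((z + inverse z) / 2) ^ 2"
proof -
  obtain i :: "'a alg_closure" where i: "i ^ 2 = -1"
    using ac_minus_one_square .
  obtain u where u: "u ^ 2 = y"
    using nth_root_exists[of 2 y] by auto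
  obtain v where v: "v ^ 2 = 1 - y"
    using nth_root_exists[of 2 "1 - y"] by auto
  define z where "z = u + i * v"
  have "z * (u - i * v) = u ^ 2 - i ^ 2 * v ^ 2"
    by (simp add: z_def algebra_simps power2_eq_square)
  hence z: "z * (u - i * v) = 1"
    using u v i by simp
  hence "inverse z = u - i * v"
    by (metis inverse_unique)
  hence "z + inverse z = 2 * u"
    by (simp add: z_def)
  moreover have "z \<noteq> 0"
    using z by auto
  ultimately show ?thesis
    using that[of z] u two_neq_0(2)[OF assms] by simp
qed

lemma one_minus_cos_square:
  fixes z i :: "'a::field"
  assumes "(2::'a) \<noteq> 0" "z \<noteq> 0" "i ^ 2 = -1"
  shows "1 - ((z + inverse z) / 2) ^ 2 = ((z - inverse z) / (2 * i)) ^ 2"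
proof -
  have four: "(4::'a) \<noteq> 0"
    using assms(1) mult_eq_0_iff[of "2::'a" 2] by simp
  have "(z - inverse z) ^ 2 = (z + inverse z) ^ 2 - 4 * (z * inverse z)"
    by (simp add: power2_eq_square algebra_simps)
  hence "(z - inverse z) ^ 2 = (z + inverse z) ^ 2 - 4"
    using assms(2) by simp
  moreover have "((z - inverse z) / (2 * i)) ^ 2 = - ((z - inverse z) ^ 2 / 4)"
    using assms(3) by (simp add: power_divide power_mult_distrib)
  ultimately show ?thesis
    using four by (simp add: power_divide field_simps)
qed

lemma power_card_cos_sin:
  fixes z i :: "'a::finite_field alg_closure"
  assumes "primepow CARD('a)"
  shows "((z + inverse z) / 2) ^ CARD('a) = (z ^ CARD('a) + inverse (z ^ CARD('a))) / 2"
    and "((z - inverse z) / (2 * i)) ^ CARD('a) =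
           (z ^ CARD('a) - inverse (z ^ CARD('a))) / (2 * i ^ CARD('a))"
  by (simp_all add: power_divide power_mult_distrib power_card_add[OF assms] two_power_card power_inverse)

text \<open>
  If \<open>u\<close> and \<open>v\<close> are the cosine and sine of \<open>z\<close>, then \<open>u\<^sup>q\<close> and \<open>\<rho>(-1) v\<^sup>q\<close> are those of
  \<open>z\<^sup>q\<close>. The sum is therefore a cosine of a difference or of a sum of two angles, which
  corresponds to \<open>z\<^bsup>q-1\<^esup>\<close> or \<open>z\<^bsup>q+1\<^esup>\<close> in the two cases; both exponents are \<open>2E\<close>.
\<close>

lemma cos_sin_power_Suc_card:
  fixes z i :: "'a::finite_field alg_closure"
  assumes "primepow CARD('a)" "odd CARD('a)" "i ^ 2 = -1" "z \<noteq> 0"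
  shows "((z + inverse z) / 2) ^ Suc CARD('a) + ((z - inverse z) / (2 * i)) ^ Suc CARD('a) =
           (z ^ (2 * E_num TYPE('a)) + inverse (z ^ (2 * E_num TYPE('a)))) / 2"
proof -
  define Z where "Z = z ^ (2 * E_num TYPE('a))"
  define z' where "z' = inverse z"
  define Z' where "Z' = inverse Z"
  have [simp]: "Z \<noteq> 0" "z \<noteq> 0"
    using assms(4) by (auto simp: Z_def)
  have zz': "z * z' = 1"
    by (simp add: z'_def)
  have two: "(2 :: 'a alg_closure) \<noteq> 0"
    using two_neq_0[OF assms(2)] by simp
  hence four: "(4 :: 'a alg_closure) \<noteq> 0"
    using mult_eq_0_iff[of "2 :: 'a alg_closure" 2] by simp
  have halve: "x / 4 + y / 4 = W / 2" if "x + y = 2 * W" for x y W :: "'a alg_closure"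
    using that two four by (simp add: field_simps)
  have ii: "i * i = -1"
    using assms(3) by (simp add: power2_eq_square)
  show ?thesis
    using assms(2,3)
  proof (cases rule: square_root_of_minus_one_cases)
    case split
    have zq: "z ^ CARD('a) = z * Z"
      unfolding Z_def using split(2) by (metis power_Suc)
    have "(z + z') * (z * Z + z' * Z') + - ((z - z') * (z * Z - z' * Z')) = 2 * (z * z') * (Z + Z')"
      by (simp add: algebra_simps)
    hence "(z + z') * (z * Z + z' * Z') / 4 + - ((z - z') * (z * Z - z' * Z')) / 4 = (Z + Z') / 2"
      by (intro halve) (simp add: zz')
    moreover have "(z - z') / (2 * i) * ((z * Z - z' * Z') / (2 * i)) =
            (z - z') * (z * Z - z' * Z') / (4 * (i * i))"
      by (simp add: mult_ac)
    ultimately show ?thesis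
      unfolding power_Suc power_card_cos_sin[OF assms(1)] split(3) zq Z_def[symmetric]
      by (simp add: ii flip: z'_def Z'_def)
  next
    case inert
    have "z * z ^ CARD('a) = Z"
      unfolding Z_def using inert(2) by (metis power_Suc)
    hence zq: "z ^ CARD('a) = z' * Z"
      by (simp add: z'_def field_simps)
    have zq': "inverse (z' * Z) = z * Z'"
      by (simp add: z'_def Z'_def)
    have "(z + z') * (z' * Z + z * Z') + (z - z') * (z' * Z - z * Z') = 2 * (z * z') * (Z + Z')"
      by (simp add: algebra_simps)
    hence "(z + z') * (z' * Z + z * Z') / 4 + (z - z') * (z' * Z - z * Z') / 4 = (Z + Z') / 2"
      by (intro halve) (simp add: zz')
    moreover have "(z - z') / (2 * i) * ((z' * Z - z * Z') / (2 * - i)) =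
            (z - z') * (z' * Z - z * Z') / (4 * - (i * i))"
      by (simp add: mult_ac)
    ultimately show ?thesis
      unfolding power_Suc power_card_cos_sin[OF assms(1)] inert(3) zq zq' Z_def[symmetric]
      by (simp add: ii zq' flip: z'_def Z'_def)
  qed
qed

text \<open>
  Here \<open>D\<^sup>q\<close> is \<open>D\<close> or \<open>1/D\<close>. In the second case \<open>D - 1/D\<close> changes its sign under Frobenius,
  and so does \<open>i\<close>; thus Frobenius fixes both quotients.
\<close>

lemma cos_sin_in_base_field:
  fixes D i :: "'a::finite_field alg_closure"
  assumes "primepow CARD('a)" "odd CARD('a)" "i ^ 2 = -1" "D ^ (2 * E_num TYPE('a)) = 1"
  obtains r t where "(D + inverse D) / 2 = to_ac r" "(D - inverse D) / (2 * i) = to_ac t"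
proof -
  have "D \<noteq> 0"
    using assms(4) E_num_even_pos(2)[OF assms(2)] by (auto simp: power_0_left)
  have "((D + inverse D) / 2) ^ CARD('a) = (D + inverse D) / 2 \<and>
        ((D - inverse D) / (2 * i)) ^ CARD('a) = (D - inverse D) / (2 * i)"
    using assms(2,3)
  proof (cases rule: square_root_of_minus_one_cases)
    case split
    have "D ^ CARD('a) = D"
      using assms(4) unfolding split(2) by simp
    thus ?thesis
      unfolding power_card_cos_sin[OF assms(1)] split(3) by simp
  next
    case inert
    have "D * D ^ CARD('a) = 1"
      using assms(4) inert(2) by (metis power_Suc)
    hence "D ^ CARD('a) = inverse D"
      by (metis inverse_unique)
    thus ?thesis
      unfolding power_card_cos_sin[OF assms(1)] inert(3)
      by (simp add: add.commute minus_divide_left)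
  qed
  thus ?thesis
    using that power_card_eq_self_imp_range by metis
qed

lemma ev_g_poly:
  fixes z :: "'a::finite_field alg_closure"
  assumes "primepow CARD('a)" "odd CARD('a)" "z \<noteq> 0"
  shows "ev (g_poly s) (((z + inverse z) / 2) ^ 2) =
           (z ^ (2 * E_num TYPE('a)) + inverse (z ^ (2 * E_num TYPE('a)))) / 2 - to_ac s"
proof -
  obtain i :: "'a alg_closure" where i: "i ^ 2 = -1"
    using ac_minus_one_square .
  define n where "n = (CARD('a) + 1) div 2"
  have n: "2 * n = Suc CARD('a)"
    using assms(2) by (auto simp: n_def)
  have "ev (g_poly s) x = x ^ n + (1 - x) ^ n - to_ac s" for x :: "'a alg_closure"
    by (simp add: g_poly_def n_def Let_def)
  thus ?thesis
    using cos_sin_power_Suc_card[OF assms(1,2) i assms(3)]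
    by (simp add: one_minus_cos_square[OF two_neq_0(2)[OF assms(2)] assms(3) i] n flip: power_mult
          del: power_Suc)
qed

lemma g_poly_eq_cheb:
  fixes s :: "'a::finite_field"
  assumes "primepow CARD('a)" "odd CARD('a)"
  shows "g_poly s = pcompose (cheb (E_num TYPE('a))) [:-1, 2:] - [:s:]"
proof (rule poly_eqI_ev)
  fix y :: "'a alg_closure"
  have two: "(2 :: 'a alg_closure) \<noteq> 0"
    using two_neq_0[OF assms(2)] by simp
  hence four: "(4 :: 'a alg_closure) \<noteq> 0"
    using mult_eq_0_iff[of "2 :: 'a alg_closure" 2] by simp
  obtain z where z: "z \<noteq> 0" "y = ((z + inverse z) / 2) ^ 2"
    using ev_cos_square[OF assms(2)] .
  have double: "-1 + y * 2 = (z ^ 2 + inverse (z ^ 2)) / 2"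
  proof -
    have "(z + inverse z) ^ 2 = z ^ 2 + inverse (z ^ 2) + 2"
      using z(1) by (simp add: power2_eq_square algebra_simps)
    hence "y = (z ^ 2 + inverse (z ^ 2) + 2) / 4"
      using z(2) by (simp add: power_divide)
    thus ?thesis
      using two four by (simp add: field_simps)
  qed
  hence "poly (cheb (E_num TYPE('a))) (-1 + y * 2) =
           ((z ^ 2) ^ E_num TYPE('a) + inverse (z ^ 2) ^ E_num TYPE('a)) / 2"
    unfolding double using z two by (intro poly_cheb) auto
  thus "ev (g_poly s) y = ev (pcompose (cheb (E_num TYPE('a))) [:-1, 2:] - [:s:]) y"
    using ev_g_poly[OF assms z(1), of s] z(2) two by (simp add: power_mult power_inverse)
qed

text \<open>
  The Chebyshev form gives the leading coefficient \<open>2\<^bsup>2E-1\<^esup>\<close>. Since \<open>2\<^sup>q = 2\<close> in the base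
  field, it is \<open>1/2\<close> or \<open>2\<close>.
\<close>

lemma degree_g_poly:
  fixes s :: "'a::finite_field"
  assumes "primepow CARD('a)" "odd CARD('a)"
  shows "degree (g_poly s) = E_num TYPE('a)"
    and "lead_coeff (g_poly s) = of_nat (tau TYPE('a)) ^ 2 / 2"
proof -
  define k where "k = E_num TYPE('a) - 1"
  have k: "E_num TYPE('a) = Suc k"
    using E_num_even_pos(2)[OF assms(2)] by (simp add: k_def)
  have two: "(2::'a) \<noteq> 0"
    using two_neq_0[OF assms(2)] by simp
  show "degree (g_poly s) = E_num TYPE('a)"
    using degree_lead_coeff_cheb_shift(1)[OF two] g_poly_eq_cheb[OF assms] k by metis
  have lc: "lead_coeff (g_poly s) = 2 ^ Suc (2 * k)"
    using degree_lead_coeff_cheb_shift(2)[OF two] g_poly_eq_cheb[OF assms] k by metis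
  have q: "(2::'a) ^ CARD('a) = 2"
    by (rule finite_field_power_card_eq_same)
  obtain i :: "'a alg_closure" where i: "i ^ 2 = -1"
    using ac_minus_one_square .
  show "lead_coeff (g_poly s) = of_nat (tau TYPE('a)) ^ 2 / 2"
    using assms(2) i
  proof (cases rule: square_root_of_minus_one_cases)
    case split
    have "CARD('a) = Suc (Suc (Suc (2 * k)))"
      using split(2) k by simp
    hence "2 * (2 * 2 ^ Suc (2 * k)) = 2 * (1::'a)"
      using q by simp
    hence "2 * 2 ^ Suc (2 * k) = (1::'a)"
      using two mult_cancel_left by blast
    thus ?thesis
      using split(1) lc two by (simp add: tau_def field_simps)
  next
    case inert
    have "CARD('a) = Suc (2 * k)"
      using inert(2) k by simp
    thus ?thesis
      using q inert(1) lc two by (simp add: tau_def field_simps)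
  qed
qed

section \<open>Irreducibility when the order is maximal\<close>

text \<open>
  The binomial expansion modulo \<open>4e\<^sup>2\<close>, with the exponent \<open>k - 1\<close> of \<open>\<epsilon>\<close> in the linear
  term replaced by \<open>k + 1\<close>. This is allowed for \<open>\<epsilon>\<^sup>2 = 1\<close> and avoids truncated subtraction.
\<close>

lemma power_expansion_mod:
  fixes e \<epsilon> :: int
  assumes "\<epsilon> ^ 2 = 1"
  obtains c where "(2 * e + \<epsilon>) ^ k = \<epsilon> ^ k + 2 * e * int k * \<epsilon> ^ Suc k + 4 * e ^ 2 * c"
proof -
  have "\<exists>c. (2 * e + \<epsilon>) ^ k = \<epsilon> ^ k + 2 * e * int k * \<epsilon> ^ Suc k + 4 * e ^ 2 * c"
  proof (induction k)
    case (Suc k)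
    then obtain c where c: "(2 * e + \<epsilon>) ^ k = \<epsilon> ^ k + 2 * e * int k * \<epsilon> ^ Suc k + 4 * e ^ 2 * c"
      by blast
    have eps: "\<epsilon> * (\<epsilon> * x) = x" for x
      using assms by (simp add: power2_eq_square flip: mult.assoc)
    have "(2 * e + \<epsilon>) ^ Suc k = \<epsilon> ^ Suc k + 2 * e * int (Suc k) * \<epsilon> ^ Suc (Suc k)
             + 4 * e ^ 2 * (int k * \<epsilon> ^ Suc k + (2 * e + \<epsilon>) * c)"
      unfolding power_Suc[of "2 * e + \<epsilon>"] c
      by (simp add: algebra_simps power2_eq_square eps)
    thus ?case by blast
  qed (auto intro: exI[of _ 0])
  thus ?thesis using that by blast
qed

text \<open>
  Modulo \<open>2e\<close> the power is \<open>\<epsilon>\<^sup>k = \<plusminus>1\<close>, and since \<open>2e \<ge> 4\<close> the signs \<open>1\<close> and \<open>-1\<close> are distinct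
  modulo \<open>2e\<close>; so \<open>\<epsilon>\<^sup>k = \<delta>\<close>. What remains modulo \<open>2e\<^sup>2\<close> is the linear term \<open>2 e k \<epsilon>\<^bsup>k+1\<^esup>\<close>,
  which forces \<open>e\<close> to divide \<open>k\<close>.
\<close>

lemma dvd_exponent_of_power_close_to_unit:
  fixes e \<epsilon> \<delta> :: int
  assumes "\<epsilon> ^ 2 = 1" "\<delta> ^ 2 = 1" "e \<ge> 2" "2 * e ^ 2 dvd (2 * e + \<epsilon>) ^ k - \<delta>"
  shows "e dvd int k"
proof -
  obtain c where c: "(2 * e + \<epsilon>) ^ k = \<epsilon> ^ k + 2 * e * int k * \<epsilon> ^ Suc k + 4 * e ^ 2 * c"
    using power_expansion_mod[OF assms(1)] .
  obtain d where d: "(2 * e + \<epsilon>) ^ k - \<delta> = 2 * e ^ 2 * d"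
    using assms(4) by (auto simp: dvd_def)
  have eq: "\<epsilon> ^ k - \<delta> = 2 * e * (e * d - int k * \<epsilon> ^ Suc k - 2 * e * c)"
    using c d by (simp add: algebra_simps power2_eq_square)
  have "(\<epsilon> ^ k) ^ 2 = 1"
    using assms(1) by (metis power_commutes power_mult power_one mult.commute)
  hence "\<epsilon> ^ k = 1 \<or> \<epsilon> ^ k = -1" and "\<delta> = 1 \<or> \<delta> = -1"
    using assms(2) by (auto simp: power2_eq_1_iff)
  hence "\<bar>\<epsilon> ^ k - \<delta>\<bar> < 2 * e"
    using assms(3) by auto
  moreover have "2 * e dvd \<epsilon> ^ k - \<delta>"
    unfolding eq by simp
  ultimately have "\<epsilon> ^ k - \<delta> = 0"
    using dvd_imp_le_int[of "\<epsilon> ^ k - \<delta>" "2 * e"] assms(3) by fastforce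
  hence "e * d - int k * \<epsilon> ^ Suc k - 2 * e * c = 0"
    using eq assms(3) by simp
  hence "int k * \<epsilon> ^ Suc k = e * (d - 2 * c)"
    by (simp add: algebra_simps)
  hence "e dvd int k * \<epsilon> ^ Suc k * \<epsilon> ^ Suc k"
    by simp
  moreover have "\<epsilon> ^ Suc k * \<epsilon> ^ Suc k = 1"
    using assms(1) by (metis power_mult_distrib power2_eq_square power_one)
  ultimately show ?thesis
    by (simp add: mult.assoc)
qed

text \<open>
  A root of \<open>f\<close> is fixed by the \<open>k\<close>-th power of Frobenius for some \<open>k\<close> between 1 and the
  degree of \<open>f\<close>; the order of the corresponding \<open>w\<close> makes \<open>k\<close> a multiple of \<open>E\<close>.
\<close>

lemma factor_degree_ge:
  fixes s :: "'a::finite_field"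
  assumes "primepow CARD('a)" "odd CARD('a)"
    and "B \<noteq> 0" "mult_order B = 2 * E_num TYPE('a)" "to_ac s = (B + inverse B) / 2"
    and "f dvd g_poly s" "f \<noteq> 0" "degree f > 0"
  shows "E_num TYPE('a) \<le> degree f"
proof -
  define E where "E = E_num TYPE('a)"
  have two: "(2 :: 'a alg_closure) \<noteq> 0"
    using two_neq_0[OF assms(2)] by simp
  hence four: "(4 :: 'a alg_closure) \<noteq> 0"
    using mult_eq_0_iff[of "2 :: 'a alg_closure" 2] by simp
  have inverse_cases: "b = a \<or> a * b = 1" if "a + inverse a = b + inverse b" "a \<noteq> 0" "b \<noteq> 0"
    for a b :: "'a alg_closure"
  proof -
    have "(b - a) * (a * b - 1) = a * b * ((b + inverse b) - (a + inverse a))"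
      using that(2,3) by (simp add: algebra_simps)
    thus ?thesis
      using that(1) by auto
  qed
  obtain y where y: "ev f y = 0"
    using alg_closed_imp_poly_has_root[of "map_poly to_ac f"] assms(8) by auto
  obtain k where k: "0 < k" "k \<le> degree f" "y ^ (CARD('a) ^ k) = y"
    using conjugate_fixed_of_root[OF assms(1,7) y] .
  obtain z where z: "z \<noteq> 0" "y = ((z + inverse z) / 2) ^ 2"
    using ev_cos_square[OF assms(2)] .
  define w where "w = z ^ 2"
  have w: "w \<noteq> 0" "y * 4 - 2 = w + inverse w"
  proof -
    have "(z + inverse z) ^ 2 = w + inverse w + 2"
      using z(1) unfolding w_def by (simp add: power2_eq_square algebra_simps)
    moreover have "y * 4 = (z + inverse z) ^ 2"
      using z(2) four by (simp add: power_divide)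
    ultimately show "y * 4 - 2 = w + inverse w"
      by simp
  qed (use z in \<open>simp add: w_def\<close>)

  have "ev (g_poly s) y = 0"
    using assms(6) y by auto
  hence "w ^ E + inverse (w ^ E) = B + inverse B"
    using ev_g_poly[OF assms(1,2) z(1), of s] z(2) assms(5) two
    by (simp add: w_def E_def power_mult)
  hence wE: "w ^ E = B \<or> w ^ E = inverse B"
    using inverse_cases[of B "w ^ E"] assms(3) w(1) by (auto dest: inverse_unique)
  \<comment> \<open>Raising \<open>w\<^sup>N = 1\<close> to the power \<open>E\<close> gives \<open>N = 2E N'\<close>. Now \<open>w\<^sup>N\<close> is the \<open>2N'\<close>-th power of \<open>w\<^sup>E\<close>,
    so \<open>2E\<close> divides \<open>2N'\<close> as well.\<close>
  have order_w: "2 * E ^ 2 dvd N" if "w ^ N = 1" for N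
  proof -
    have ord: "2 * E dvd M" if "(w ^ E) ^ M = 1" for M
    proof -
      have "B ^ M = 1"
        using wE that by (auto simp: power_inverse)
      thus ?thesis
        using power_eq_1_iff_mult_order_dvd[OF assms(3)] assms(4) by (simp add: E_def)
    qed
    have "(w ^ E) ^ N = 1"
      using that by (metis power_mult mult.commute power_one)
    then obtain N' where N': "N = 2 * E * N'"
      using ord by (auto simp: dvd_def)
    have "(w ^ E) ^ (2 * N') = w ^ N"
      by (simp add: N' mult_ac flip: power_mult)
    hence "2 * E dvd 2 * N'"
      using ord that by metis
    thus ?thesis
      by (simp add: N' power2_eq_square)
  qed

  define Q where "Q = CARD('a) ^ k"
  have Q: "Q \<ge> 1"
    by (simp add: Q_def Suc_leI)
  have "(y * 4 - 2) ^ Q = y * 4 - 2"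
    using k(3) to_ac_power_card_power[of "2::'a" k] to_ac_power_card_power[of "4::'a" k]
    by (simp add: Q_def power_card_power_diff[OF assms(1)] power_mult_distrib)
  hence "w + inverse w = w ^ Q + inverse (w ^ Q)"
    unfolding w(2) by (simp add: Q_def power_card_power_add[OF assms(1)] power_inverse)
  hence "w ^ Q = w \<or> w * w ^ Q = 1"
    using inverse_cases[of w "w ^ Q"] w(1) by auto
  hence "\<exists>\<delta>::int. \<delta> ^ 2 = 1 \<and> 2 * int E ^ 2 dvd int Q - \<delta>"
  proof
    assume "w ^ Q = w"
    hence "w * w ^ (Q - 1) = w * 1"
      using Q by (simp flip: power_Suc)
    hence "w ^ (Q - 1) = 1"
      using w(1) mult_cancel_left by blast
    hence "int (2 * E ^ 2) dvd int (Q - 1)"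
      using order_w of_nat_dvd_iff by blast
    thus ?thesis
      using Q by (intro exI[of _ 1]) (simp add: of_nat_diff)
  next
    assume "w * w ^ Q = 1"
    hence "int (2 * E ^ 2) dvd int (Suc Q)"
      using order_w[of "Suc Q"] of_nat_dvd_iff by (metis power_Suc)
    thus ?thesis
      by (intro exI[of _ "-1"]) (simp add: add.commute)
  qed
  moreover have "\<exists>\<epsilon>::int. \<epsilon> ^ 2 = 1 \<and> int CARD('a) = 2 * int E + \<epsilon>"
  proof -
    obtain i :: "'a alg_closure" where i: "i ^ 2 = -1"
      using ac_minus_one_square .
    show ?thesis
      using assms(2) i
    proof (cases rule: square_root_of_minus_one_cases)
      case split
      thus ?thesis by (intro exI[of _ 1]) (simp add: E_def)
    next
      case inert
      have "int (Suc CARD('a)) = int (2 * E)"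
        using inert(2) by (simp only: E_def)
      thus ?thesis by (intro exI[of _ "-1"]) simp
    qed
  qed
  ultimately obtain \<delta> \<epsilon> :: int where "\<delta> ^ 2 = 1" "\<epsilon> ^ 2 = 1" "2 * int E ^ 2 dvd (2 * int E + \<epsilon>) ^ k - \<delta>"
    unfolding Q_def by (metis of_nat_power)
  hence "int E dvd int k"
    using dvd_exponent_of_power_close_to_unit[of \<epsilon> \<delta> "int E" k] E_num_even_pos(2)[OF assms(2)]
    by (simp add: E_def)
  hence "E \<le> k"
    using k(1) by (simp add: dvd_imp_le)
  thus ?thesis
    using k(2) by (simp add: E_def)
qed

lemma irreducible_g_poly:
  fixes s :: "'a::finite_field"
  assumes "primepow CARD('a)" "odd CARD('a)"
    and "B \<noteq> 0" "mult_order B = 2 * E_num TYPE('a)" "to_ac s = (B + inverse B) / 2"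
  shows "Factorial_Ring.irreducible (g_poly s)"
proof (rule Factorial_Ring.irreducibleI)
  note deg = degree_g_poly(1)[OF assms(1,2), of s] and E = E_num_even_pos(2)[OF assms(2)]
  show ne: "g_poly s \<noteq> 0"
    using deg E by auto
  show "\<not> is_unit (g_poly s)"
    using deg E ne by (simp add: is_unit_iff_degree)
  fix f h
  assume fh: "g_poly s = f * h"
  hence nz: "f \<noteq> 0" "h \<noteq> 0"
    using ne by auto
  hence "degree f + degree h = E_num TYPE('a)"
    using fh deg by (simp add: degree_mult_eq)
  moreover have "E_num TYPE('a) \<le> degree f" if "degree f > 0"
    using factor_degree_ge[OF assms _ nz(1) that] fh by simp
  moreover have "E_num TYPE('a) \<le> degree h" if "degree h > 0"
    using factor_degree_ge[OF assms _ nz(2) that] fh by simp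
  ultimately have "degree f = 0 \<or> degree h = 0"
    using E by linarith
  thus "is_unit f \<or> is_unit h"
    using nz by (simp add: is_unit_iff_degree)
qed

section \<open>A proper factor when the order is not maximal\<close>

text \<open>
  An order smaller than \<open>2E\<close> leaves room to take an \<open>l\<close>-th root \<open>D\<close> of \<open>B\<close> inside the group of
  \<open>2E\<close>-th roots of unity, for a prime divisor \<open>l\<close> of \<open>E\<close>. Its cosine \<open>r\<close> is a root of \<open>T\<^sub>l -
  s\<close> in the base field, and the linear factor of this root becomes a proper factor of \<open>g\<^sub>s\<close>
  after composition with \<open>T\<^bsub>E/l\<^esub>(2y - 1)\<close>.
\<close>

lemma g_poly_reducible:
  fixes s :: "'a::finite_field"
  assumes "primepow CARD('a)" "odd CARD('a)"
    and "B \<noteq> 0" "B ^ (2 * E_num TYPE('a)) = 1" "to_ac s = (B + inverse B) / 2"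
    and "mult_order B \<noteq> 2 * E_num TYPE('a)"
  shows "\<not> Factorial_Ring.irreducible (g_poly s)"
proof
  assume irr: "Factorial_Ring.irreducible (g_poly s)"
  define E where "E = E_num TYPE('a)"
  have E: "E \<ge> 2" "even E"
    using E_num_even_pos[OF assms(2)] by (simp_all add: E_def)
  have two: "(2 :: 'a) \<noteq> 0" "(2 :: 'a alg_closure) \<noteq> 0"
    using two_neq_0[OF assms(2)] by simp_all
  obtain d where d: "2 * E = mult_order B * d"
    using power_eq_1_iff_mult_order_dvd[OF assms(3)] assms(4) by (auto simp: E_def dvd_def)
  have "d \<noteq> 1"
    using d assms(6) by (auto simp: E_def)
  then obtain l where l: "Factorial_Ring.prime l" "l dvd d"
    using prime_factor_nat by blast
  have "l dvd 2 * E"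
    using l(2) d by simp
  \<comment> \<open>If \<open>l = 2\<close>, this needs that \<open>E\<close> is even.\<close>
  hence "l dvd E"
    using l(1) E(2) by (metis dvd_trans prime_dvd_mult_iff)
  then obtain m where m: "E = l * m"
    by (auto simp: dvd_def)
  have "B ^ (2 * m) = 1"
  proof -
    obtain d' where d': "d = l * d'"
      using l(2) by (auto simp: dvd_def)
    hence "l * (2 * m) = l * (mult_order B * d')"
      using d m d' by (metis mult.left_commute)
    hence "2 * m = mult_order B * d'"
      using prime_gt_0_nat[OF l(1)] by (metis mult_left_cancel nat_neq_iff)
    thus ?thesis
      using power_eq_1_iff_mult_order_dvd[OF assms(3)] by simp
  qed
  obtain D where D: "D ^ l = B"
    using nth_root_exists[of l B] prime_gt_0_nat[OF l(1)] by blast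
  have "D ^ (2 * E) = (D ^ l) ^ (2 * m)"
    by (simp add: m mult_ac flip: power_mult)
  hence "D ^ (2 * E) = 1"
    using D \<open>B ^ (2 * m) = 1\<close> by simp
  moreover obtain i :: "'a alg_closure" where i: "i ^ 2 = -1"
    using ac_minus_one_square .
  ultimately obtain r where r: "(D + inverse D) / 2 = to_ac r"
    using cos_sin_in_base_field[OF assms(1,2) i] by (metis E_def)
  have "D \<noteq> 0"
    using D assms(3) prime_gt_0_nat[OF l(1)] by (auto simp: power_0_left)
  hence "ev (cheb l) (to_ac r) = to_ac s"
    unfolding ev_cheb assms(5) r[symmetric]
    using poly_cheb[of D l] two D by (simp add: power_inverse)
  hence "poly (cheb l - [:s:]) r = 0"
    by (simp only: ev_to_ac to_ac_eq_iff) simp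
  then obtain h where h: "cheb l - [:s:] = [:-r, 1:] * h"
    by (metis poly_eq_0_iff_dvd dvdE)
  define G where "G = pcompose (cheb m) [:-1, 2 :: 'a:] - [:r:]"
  define H where "H = pcompose (pcompose h (cheb m)) [:-1, 2:]"
  have "g_poly s = pcompose (pcompose (cheb l - [:s:]) (cheb m)) [:-1, 2:]"
    unfolding g_poly_eq_cheb[OF assms(1,2)] E_def[symmetric] m cheb_mult
    by (simp add: pcompose_diff)
  also have "\<dots> = G * H"
    unfolding h pcompose_mult H_def G_def by (simp add: pcompose_pCons pcompose_add pcompose_diff)
  finally have GH: "g_poly s = G * H" .
  have "m \<noteq> 0"
    using m E(1) by (cases m) auto
  hence "m < E"
    using m prime_gt_1_nat[OF l(1)] by simp
  have "degree G = m"
    using degree_lead_coeff_cheb_shift(1)[OF two(1), of "m - 1" r] \<open>m \<noteq> 0\<close> by (simp add: G_def)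
  moreover have "degree (g_poly s) = E"
    using degree_g_poly(1)[OF assms(1,2)] by (simp add: E_def)
  moreover from this have "G \<noteq> 0" "H \<noteq> 0"
    using GH E(1) by auto
  moreover from this have "degree (g_poly s) = degree G + degree H"
    unfolding GH by (rule degree_mult_eq)
  ultimately have "\<not> is_unit G" "\<not> is_unit H"
    using \<open>m \<noteq> 0\<close> \<open>m < E\<close> by (simp_all add: is_unit_iff_degree)
  thus False
    using irr GH Factorial_Ring.irreducibleD by blast
qed

text \<open>
  The element \<open>s + it\<close> with \<open>s\<^sup>2 + t\<^sup>2 = 1\<close> has the inverse \<open>s - it\<close>. Frobenius maps it to
  itself or to its inverse, according to its action on \<open>i\<close>.
\<close>

lemma exists_witness:
  fixes s :: "'a::finite_field" and i :: "'a alg_closure"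
  assumes "primepow CARD('a)" "odd CARD('a)" "i ^ 2 = -1" "1 - s ^ 2 \<in> setC"
  obtains B where "B \<in> adjoin i" "B \<noteq> 0" "B ^ (2 * E_num TYPE('a)) = 1"
    "to_ac s = (B + inverse B) / 2"
proof -
  obtain t where t: "1 - s ^ 2 = t ^ 2"
    using assms(4) by (auto simp: setC_def quad_char_def is_nth_power_def split: if_splits)
  define B where "B = to_ac s + i * to_ac t"
  define B' where "B' = to_ac s - i * to_ac t"
  have "B * B' = to_ac s ^ 2 - i ^ 2 * to_ac t ^ 2"
    by (simp add: B_def B'_def algebra_simps power2_eq_square)
  also have "\<dots> = to_ac (s ^ 2 + t ^ 2)"
    using assms(3) by simp
  also have "\<dots> = 1"
    by (simp flip: t)
  finally have BB': "B * B' = 1" .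
  hence inv: "inverse B = B'"
    by (rule inverse_unique)
  have Bq: "B ^ CARD('a) = to_ac s + i ^ CARD('a) * to_ac t"
    by (simp add: B_def power_card_add[OF assms(1)] power_mult_distrib)
  have nz: "B \<noteq> 0"
    using BB' by auto
  have "B ^ (2 * E_num TYPE('a)) = 1"
    using assms(2,3)
  proof (cases rule: square_root_of_minus_one_cases)
    case split
    have "B * B ^ (2 * E_num TYPE('a)) = B * 1"
      using Bq unfolding split(3) by (simp add: split(2) flip: B_def)
    thus ?thesis
      using nz mult_cancel_left by blast
  next
    case inert
    have "B ^ CARD('a) = B'"
      unfolding Bq inert(3) by (simp add: B'_def)
    hence "B ^ Suc CARD('a) = 1"
      using BB' by simp
    thus ?thesis
      by (simp only: inert(2))
  qed
  moreover have "B \<in> adjoin i"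
    unfolding adjoin_def B_def by (auto intro!: exI[of _ "[:s, t:]"])
  moreover have "to_ac s = (B + inverse B) / 2"
    using two_neq_0(2)[OF assms(2)] unfolding inv by (simp add: B_def B'_def)
  ultimately show ?thesis
    using that nz by blast
qed

section \<open>The explicit factorisation\<close>

lemma order_eq_1I:
  fixes p :: "'a::field poly"
  assumes "poly p a = 0" "poly (pderiv p) a \<noteq> 0"
  shows "order a p = 1"
proof -
  obtain r where r: "p = [:-a, 1:] * r"
    using assms(1) by (metis poly_eq_0_iff_dvd dvdE)
  have "poly r a \<noteq> 0"
    using assms(2) unfolding r by (simp add: pderiv_mult pderiv_pCons del: mult_pCons_left)
  moreover from this have "r \<noteq> 0"
    by auto
  moreover from this have "[:-a, 1:] * r \<noteq> 0"
    by (subst mult_eq_0_iff) simp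
  moreover have "order a [:-a, 1:] = 1"
    using order_power_n_n[of a 1] by simp
  ultimately show ?thesis
    unfolding r by (subst order_mult) (auto simp: order_0I)
qed

text \<open>
  If \<open>p = (y - a) r\<close>, then \<open>p'(a) = r(a)\<close> and \<open>p''(a) = 2 r'(a)\<close>, so the criterion for a
  simple root applies to \<open>r\<close>. In characteristic 2 the last hypothesis cannot hold.
\<close>

lemma order_eq_2I:
  fixes p :: "'a::field poly"
  assumes "poly p a = 0" "poly (pderiv p) a = 0" "poly (pderiv (pderiv p)) a \<noteq> 0"
  shows "order a p = 2"
proof -
  obtain r where r: "p = [:-a, 1:] * r"
    using assms(1) by (metis poly_eq_0_iff_dvd dvdE)
  have "poly r a = 0"
    using assms(2) unfolding r by (simp add: pderiv_mult pderiv_pCons del: mult_pCons_left)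
  moreover have "poly (pderiv r) a \<noteq> 0"
    using assms(3) unfolding r
    by (auto simp: pderiv_mult pderiv_pCons pderiv_add simp del: mult_pCons_left)
  ultimately have "order a r = 1"
    by (rule order_eq_1I)
  moreover from this have "r \<noteq> 0"
    using \<open>poly (pderiv r) a \<noteq> 0\<close> by auto
  moreover from this have "[:-a, 1:] * r \<noteq> 0"
    by (subst mult_eq_0_iff) simp
  moreover have "order a [:-a, 1:] = 1"
    using order_power_n_n[of a 1] by simp
  ultimately show ?thesis
    unfolding r by (subst order_mult) auto
qed

lemma setC_iff:
  "a \<in> setC \<longleftrightarrow> a \<noteq> 0 \<and> a \<noteq> 1 \<and> is_square a \<and> is_square (1 - a)"
  by (auto simp: setC_def quad_char_def)

lemma square_power_half_card:
  fixes a :: "'a::finite_field"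
  assumes "is_square a" "2 * n = Suc CARD('a)"
  shows "a ^ n = a"
proof -
  obtain t where t: "a = t ^ 2"
    using assms(1) by (auto simp: is_nth_power_def)
  have "a ^ n = t ^ Suc CARD('a)"
    by (simp only: t assms(2) flip: power_mult)
  also have "\<dots> = t * t"
    by (simp add: finite_field_power_card_eq_same)
  finally show ?thesis
    by (simp add: t power2_eq_square)
qed

lemma of_nat_half_card:
  assumes "2 * n = Suc CARD('a::finite_field)"
  shows "2 * (of_nat n :: 'a) = 1" "2 * (of_nat (n - 1) :: 'a) = -1"
proof -
  have q: "of_nat CARD('a) = (0::'a)"
    using CHAR_dvd_CARD[where 'a = 'a] of_nat_eq_0_iff_char_dvd by blast
  have "of_nat (2 * n) = (1::'a)"
    unfolding assms by (simp add: q)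
  thus 1: "2 * (of_nat n :: 'a) = 1"
    by simp
  have "n \<ge> 1"
    using assms by (cases n) auto
  thus "2 * (of_nat (n - 1) :: 'a) = -1"
    using 1 by (simp add: of_nat_diff algebra_simps)
qed

context
  fixes n :: nat and P :: "'a::finite_field poly"
  assumes n: "2 * n = Suc CARD('a)" and P: "P = g_poly 1"
begin

private lemma n_ge_2: "n \<ge> 2"
  using n card_field_gt_1[where 'a = 'a] by linarith

private lemma P_eq: "P = [:0, 1:] ^ n + [:1, -1:] ^ n - 1"
  using n by (auto simp: P g_poly_def Let_def one_pCons simp flip: n)

private lemma pderiv_P:
  "pderiv P = smult (of_nat n) ([:0, 1:] ^ (n - 1) - [:1, -1:] ^ (n - 1))"
  unfolding P_eq by (simp add: pderiv_add pderiv_diff pderiv_power pderiv_pCons smult_diff_right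
      smult_add_right)

private lemma pderiv2_P:
  "pderiv (pderiv P) =
     smult (of_nat n * of_nat (n - 1)) ([:0, 1:] ^ (n - 2) + [:1, -1:] ^ (n - 2))"
  unfolding pderiv_P by (simp add: pderiv_add pderiv_diff pderiv_power pderiv_pCons pderiv_smult
      smult_diff_right smult_add_right numeral_2_eq_2)

private lemma poly_P: "poly P a = a ^ n + (1 - a) ^ n - 1"
  by (simp add: P_eq)

lemma g_poly_1_roots_order:
  assumes "a = 0 \<or> a = 1"
  shows "poly P a = 0" "order a P = 1"
proof -
  show 0: "poly P a = 0"
    using assms n_ge_2 by (auto simp: poly_P power_0_left)
  have "of_nat n \<noteq> (0::'a)"
    using of_nat_half_card(1)[OF n] by auto
  hence "poly (pderiv P) a \<noteq> 0"
    using assms n_ge_2 by (auto simp: pderiv_P power_0_left)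
  with 0 show "order a P = 1"
    by (rule order_eq_1I)
qed

text \<open>
  An element \<open>a\<close> of \<open>C\<close> satisfies \<open>a\<^sup>n = a\<close>, hence \<open>a\<^bsup>n-1\<^esup> = 1\<close> and \<open>a\<^bsup>n-2\<^esup> = 1/a\<close>, and
  likewise for \<open>1 - a\<close>. So the first derivative vanishes at \<open>a\<close>, and the second one is \<open>n (n -
  1) / (a (1 - a)) = -1 / (4 a (1 - a))\<close>.
\<close>

lemma g_poly_1_setC_order:
  assumes "a \<in> setC"
  shows "poly P a = 0" "order a P = 2"
proof -
  have a: "a \<noteq> 0" "1 - a \<noteq> 0" "a ^ n = a" "(1 - a) ^ n = 1 - a"
    using assms square_power_half_card[OF _ n] by (auto simp: setC_iff)
  show 0: "poly P a = 0"
    by (simp add: poly_P a)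
  have p1: "x ^ (n - 1) = 1" and p2: "x * x ^ (n - 2) = 1" if "x \<noteq> 0" "x ^ n = x" for x :: 'a
  proof -
    have "x * x ^ (n - 1) = x * 1"
      using that(2) n_ge_2 by (simp flip: power_Suc)
    thus p1: "x ^ (n - 1) = 1"
      using that(1) mult_cancel_left by blast
    have "n - 1 = Suc (n - 2)"
      using n_ge_2 by simp
    thus "x * x ^ (n - 2) = 1"
      using p1 by simp
  qed
  have 1: "poly (pderiv P) a = 0"
    using p1[OF a(1,3)] p1[OF a(2,4)] by (simp add: pderiv_P)
  have expand: "c * d * (x + y) = d * (c * x) + c * (d * y)" for c d x y :: 'a
    by (simp add: algebra_simps)
  have "a * (1 - a) * (a ^ (n - 2) + (1 - a) ^ (n - 2)) = (1 - a) * (a * a ^ (n - 2)) + a * ((1 - a) * (1 - a) ^ (n - 2))"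
    by (rule expand)
  also have "\<dots> = 1"
    unfolding p2[OF a(1,3)] p2[OF a(2,4)] by simp
  finally have "a ^ (n - 2) + (1 - a) ^ (n - 2) \<noteq> 0"
    by auto
  moreover have "of_nat n \<noteq> (0::'a)" "of_nat (n - 1) \<noteq> (0::'a)"
    using of_nat_half_card[OF n] by (auto simp del: of_nat_diff)
  ultimately have "poly (pderiv (pderiv P)) a \<noteq> 0"
    by (simp add: pderiv2_P)
  with 0 1 show "order a P = 2"
    by (rule order_eq_2I)
qed

end

text \<open>
  At such a root \<open>Z = z\<^bsup>2E\<^esup>\<close> satisfies \<open>Z + 1/Z = 2\<close>, so \<open>Z = 1\<close>. Then \<open>y\<close> and \<open>1 - y\<close> are the
  squares of a cosine and a sine, both of which lie in the base field.
\<close>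

lemma g_poly_1_root_cases:
  fixes y :: "'a::finite_field alg_closure"
  assumes "primepow CARD('a)" "odd CARD('a)" "ev (g_poly 1) y = 0"
  obtains a where "y = to_ac a" "a = 0 \<or> a = 1 \<or> a \<in> setC"
proof -
  have two: "(2 :: 'a alg_closure) \<noteq> 0"
    using two_neq_0[OF assms(2)] by simp
  obtain i :: "'a alg_closure" where i: "i ^ 2 = -1"
    using ac_minus_one_square .
  obtain z where z: "z \<noteq> 0" "y = ((z + inverse z) / 2) ^ 2"
    using ev_cos_square[OF assms(2)] .
  define Z where "Z = z ^ (2 * E_num TYPE('a))"
  have "Z \<noteq> 0"
    using z(1) by (simp add: Z_def)
  hence "(Z - 1) ^ 2 = Z * (Z + inverse Z - 2)"
    by (simp add: power2_eq_square algebra_simps)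
  moreover have "Z + inverse Z = 2"
    using ev_g_poly[OF assms(1,2) z(1), of 1] assms(3) z(2) two by (simp add: Z_def)
  ultimately have "(Z - 1) ^ 2 = 0"
    by simp
  hence "z ^ (2 * E_num TYPE('a)) = 1"
    by (simp add: Z_def)
  then obtain r t where rt: "(z + inverse z) / 2 = to_ac r" "(z - inverse z) / (2 * i) = to_ac t"
    using cos_sin_in_base_field[OF assms(1,2) i] by blast
  have "to_ac (1 - r ^ 2) = to_ac (t ^ 2)"
    using one_minus_cos_square[OF two z(1) i] by (simp only: rt to_ac_diff to_ac_power to_ac_1)
  hence "1 - r ^ 2 = t ^ 2"
    by (simp only: to_ac_eq_iff)
  hence "r ^ 2 = 0 \<or> r ^ 2 = 1 \<or> r ^ 2 \<in> setC"
    by (auto simp: setC_iff is_nth_power_def)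
  moreover have "y = to_ac (r ^ 2)"
    by (simp only: z(2) rt(1) to_ac_power)
  ultimately show ?thesis
    using that by blast
qed

lemma g_poly_product:
  fixes s :: "'a::finite_field"
  assumes "primepow CARD('a)" "odd CARD('a)"
  shows "g_poly s = smult (of_nat (tau TYPE('a)) ^ 2 / 2)
                         (([:0, 1:] ^ 2 - [:0, 1:]) * (\<Prod>a\<in>setC. ([:0, 1:] - [:a:]) ^ 2))
                       + [:1 - s:]"
proof -
  define P where "P = g_poly (1::'a)"
  define n where "n = (CARD('a) + 1) div 2"
  have n: "2 * n = Suc CARD('a)"
    using assms(2) by (auto simp: n_def)
  note ord01 = g_poly_1_roots_order[OF n P_def] and ordC = g_poly_1_setC_order[OF n P_def]
  have "degree P \<ge> 2"
    using degree_g_poly(1)[OF assms, of 1] E_num_even_pos(2)[OF assms(2)] by (simp add: P_def)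
  hence "P \<noteq> 0"
    by auto
  have "{a. poly P a = 0} = insert 0 (insert 1 setC)"
  proof (intro equalityI subsetI)
    fix a assume "a \<in> {a. poly P a = 0}"
    hence "ev (g_poly 1) (to_ac a) = 0"
      by (simp add: P_def)
    thus "a \<in> insert 0 (insert 1 setC)"
      using g_poly_1_root_cases[OF assms] to_ac_eq_iff by (metis insert_iff)
  qed (use ord01(1) ordC(1) in auto)
  moreover have "x \<in> range to_ac" if "ev P x = 0" for x
    using g_poly_1_root_cases[OF assms that[unfolded P_def]] by blast
  ultimately have "P = smult (lead_coeff P) (\<Prod>a\<in>insert 0 (insert 1 setC). [:-a, 1:] ^ order a P)"
    using prod_roots_order[OF \<open>P \<noteq> 0\<close>] by simp
  also have "(\<Prod>a\<in>insert 0 (insert 1 setC). [:-a, 1:] ^ order a P) =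
               [:0, 1:] * ([:-1, 1:] * (\<Prod>a\<in>setC. [:-a, 1:] ^ order a P))"
    by (subst prod.insert | simp add: setC_iff ord01 del: mult_pCons_left)+
  also have "(\<Prod>a\<in>setC. [:-a, 1:] ^ order a P) = (\<Prod>a\<in>setC. ([:0, 1:] - [:a:]) ^ 2)"
    by (intro prod.cong) (simp_all add: ordC(2))
  also have "[:0, 1:] * ([:-1, 1:] * (\<Prod>a\<in>setC. ([:0, 1:] - [:a:]) ^ 2)) =
               ([:0, 1:] ^ 2 - [:0, 1:]) * (\<Prod>a\<in>setC. ([:0, 1:] - [:a:]) ^ 2 :: 'a poly)"
    unfolding mult.assoc[symmetric] by (rule arg_cong2[of _ _ _ _ "(*)"]) (simp_all add: power2_eq_square)
  also have "lead_coeff P = of_nat (tau TYPE('a)) ^ 2 / 2"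
    using degree_g_poly(2)[OF assms, of 1] by (simp add: P_def)
  finally have "P = smult (of_nat (tau TYPE('a)) ^ 2 / 2)
      (([:0, 1:] ^ 2 - [:0, 1:]) * (\<Prod>a\<in>setC. ([:0, 1:] - [:a:]) ^ 2))" .
  moreover have "g_poly s = P + [:1 - s:]"
    by (simp add: P_def g_poly_def Let_def)
  ultimately show ?thesis
    by simp
qed

section \<open>The criterion\<close>

theorem corollary4p13:
  fixes s :: "'a::finite_field" and i :: "'a alg_closure"
  assumes "primepow CARD('a)" and "odd CARD('a)"
    and "i ^ 2 = -1"
    and "1 - s ^ 2 \<in> setC"
  shows "(Factorial_Ring.irreducible (g_poly s) \<longleftrightarrow>
            (\<exists>B \<in> adjoin i. B \<noteq> 0 \<and> mult_order B = 2 * E_num TYPE('a) \<and>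
                to_ac s = (B + inverse B) / 2))
       \<and> ((\<exists>B \<in> adjoin i. B \<noteq> 0 \<and> mult_order B = 2 * E_num TYPE('a) \<and>
                to_ac s = (B + inverse B) / 2) \<longrightarrow>
            Factorial_Ring.irreducible (g_poly s) \<and>
            g_poly s = smult (of_nat (tau TYPE('a)) ^ 2 / 2)
                         (([:0, 1:] ^ 2 - [:0, 1:]) * (\<Prod>a\<in>setC. ([:0, 1:] - [:a:]) ^ 2))
                       + [:1 - s:])"
proof (intro conjI iffI impI)
  let ?W = "\<exists>B \<in> adjoin i. B \<noteq> 0 \<and> mult_order B = 2 * E_num TYPE('a) \<and>
              to_ac s = (B + inverse B) / 2"
  show W: "Factorial_Ring.irreducible (g_poly s)" if ?W
    using that irreducible_g_poly[OF assms(1,2)] by blast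
  show "Factorial_Ring.irreducible (g_poly s)" if ?W
    using that by (rule W)
  show "g_poly s = smult (of_nat (tau TYPE('a)) ^ 2 / 2)
          (([:0, 1:] ^ 2 - [:0, 1:]) * (\<Prod>a\<in>setC. ([:0, 1:] - [:a:]) ^ 2)) + [:1 - s:]"
    by (rule g_poly_product[OF assms(1,2)])
  assume irr: "Factorial_Ring.irreducible (g_poly s)"
  obtain B where B: "B \<in> adjoin i" "B \<noteq> 0" "B ^ (2 * E_num TYPE('a)) = 1"
      "to_ac s = (B + inverse B) / 2"
    using exists_witness[OF assms] .
  have "mult_order B = 2 * E_num TYPE('a)"
    using g_poly_reducible[OF assms(1,2) B(2-4)] irr by blast
  thus ?W
    using B by blast
qed

end
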